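(* Let $V \subset \mathbb{C}^n$ be an algebraic variety. Let $\{g_1,\ldots,g_k\}$ be a Gröbner basis for $\mathbf{I}(V)$ with respect to a degree ordering. Then $$C_\infty(V) = \mathbf{V}\big(g_1^h|_{x_0=0}, \ldots, g_k^h|_{x_0=0}\big).$$
   Context: An algebraic variety $V \subset \mathbb{C}^n$ is the common zero set of a set of polynomials in $\mathbb{C}[x_1,\ldots,x_n]$ (not necessarily irreducible). $\mathbf{I}(V)$ is the ideal of all polynomials in $\mathbb{C}[x_1,\ldots,x_n]$ vanishing on $V$, and $\mathbf{V}(\cdot)$ denotes the common zero set in $\mathbb{C}^n$ of a collection of polynomials in $\mathbb{C}[x_1,\ldots,x_n]$. For a nonzero polynomial $f$, $f^*$ denotes its homogeneous component of highest degree (and $0^* := 0$). A degree ordering is a monomial ordering on $\mathbb{C}[x_1,\ldots,x_n]$ for which every monomial of larger total degree is larger. The geometric tangent cone of $V$ at infinity, $C_{g,\infty}(V)$, is the set of $v \in \mathbb{C}^n$ for which there exist a sequence $\{x_k\}_{k\in\mathbb{N}} \subset V$ with $\|x_k\| \to \infty$ and a sequence $\{t_k\}_{k\in\mathbb{N}} \subset \mathbb{C}$ with $t_k x_k \to v$; in addition, by convention, $0 \in C_{g,\infty}(V)$ whenever $V \neq \emptyset$. The algebraic tangent cone of $V$ at infinity is $C_{a,\infty}(V) := \{ v \in \mathbb{C}^n \mid f^*(v) = 0 \text{ for all } f \in \mathbf{I}(V) \}$. These two sets are equal, and $C_\infty(V) := C_{a,\infty}(V) = C_{g,\infty}(V)$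 denotes their common value. For a polynomial $f \in \mathbb{C}[x_1,\ldots,x_n]$ of degree $d$, its homogenization is $f^h(x_0,x_1,\ldots,x_n) := x_0^d f\left(\frac{x_1}{x_0},\ldots,\frac{x_n}{x_0}\right) \in \mathbb{C}[x_0,x_1,\ldots,x_n]$, with $x_0$ a new variable (and $0^h := 0$). For $g \in \mathbb{C}[x_0,x_1,\ldots,x_n]$, $g|_{x_0=0} := g(0,x_1,\ldots,x_n) \in \mathbb{C}[x_1,\ldots,x_n]$. *)

theory Defs
  imports "HOL-Analysis.Analysis" "HOL-Library.Poly_Mapping"
begin

section \<open>Polynomials in several variables\<close>

text \<open>
  Monomials are finitely supported exponent vectors, and polynomials are finitely supported
  families of coefficients indexed by monomials; the ring structure is the convolution product of
  \<^theory>\<open>HOL-Library.Poly_Mapping\<close>. The linear order on \<^type>\<open>poly_mapping\<close>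
  provided there is never used.
\<close>

type_synonym 'v monom = "'v \<Rightarrow>\<^sub>0 nat"
type_synonym ('v, 'a) mpoly = "'v monom \<Rightarrow>\<^sub>0 'a"

definition mvar :: "'v \<Rightarrow> ('v, 'a::zero_neq_one) mpoly" where
  "mvar i = Poly_Mapping.single (Poly_Mapping.single i 1) 1"

definition mconst :: "'a::zero \<Rightarrow> ('v, 'a) mpoly" where
  "mconst c = Poly_Mapping.single 0 c"

text \<open>
  The evaluation of a polynomial in a commutative ring: coefficients are mapped by \<open>\<phi>\<close>
  and each variable \<open>i\<close> is replaced by \<open>a i\<close>.
\<close>

definition eval_with ::
  "('a::zero \<Rightarrow> 'b) \<Rightarrow> ('v \<Rightarrow> 'b) \<Rightarrow> ('v, 'a) mpoly \<Rightarrow> 'b::comm_ring_1" where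
  "eval_with \<phi> a f =
    (\<Sum>m\<in>Poly_Mapping.keys f.
      \<phi> (Poly_Mapping.lookup f m) * (\<Prod>i\<in>Poly_Mapping.keys m. a i ^ Poly_Mapping.lookup m i))"

definition eval_at :: "('v \<Rightarrow> 'a) \<Rightarrow> ('v, 'a) mpoly \<Rightarrow> 'a::comm_ring_1" where
  "eval_at = eval_with id"

definition subst_poly ::
  "('v \<Rightarrow> ('w, 'a) mpoly) \<Rightarrow> ('v, 'a) mpoly \<Rightarrow> ('w, 'a::comm_ring_1) mpoly" where
  "subst_poly = eval_with mconst"

definition mdeg :: "'v monom \<Rightarrow> nat" where
  "mdeg m = (\<Sum>i\<in>Poly_Mapping.keys m. Poly_Mapping.lookup m i)"

text \<open>The zero polynomial gets degree 0; this has no influence on the notions below.\<close>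

definition total_degree :: "('v, 'a::zero) mpoly \<Rightarrow> nat" where
  "total_degree f = Max (insert 0 (mdeg ` Poly_Mapping.keys f))"

text \<open>The component $f^*$ of highest degree, with $0^* = 0$.\<close>

definition top_form :: "('v, 'a) mpoly \<Rightarrow> ('v, 'a::comm_monoid_add) mpoly" where
  "top_form f =
    (\<Sum>m\<in>{m \<in> Poly_Mapping.keys f. mdeg m = total_degree f}.
      Poly_Mapping.single m (Poly_Mapping.lookup f m))"

text \<open>
  For homogenization the variables are indexed by \<^typ>\<open>'v option\<close>: the new variable
  $x_0$ is \<^const>\<open>None\<close> and $x_i$ becomes \<open>Some i\<close>. Clearing denominators in
  $x_0^d f(x_1/x_0, \ldots, x_n/x_0)$ multiplies each monomial $x^m$ of $f$ by $x_0^{d - |m|}$;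
  the subtraction on \<^typ>\<open>nat\<close> does not truncate because $|m| \le d$. The lemma
  \<open>eval_homogenize\<close> below recovers the formula with the denominators.
\<close>

definition homogenize :: "('v, 'a) mpoly \<Rightarrow> ('v option, 'a::comm_ring_1) mpoly" where
  "homogenize f =
    (\<Sum>m\<in>Poly_Mapping.keys f.
      mconst (Poly_Mapping.lookup f m) * mvar None ^ (total_degree f - mdeg m) *
      (\<Prod>i\<in>Poly_Mapping.keys m. mvar (Some i) ^ Poly_Mapping.lookup m i))"

text \<open>The substitution $g|_{x_0 = 0} = g(0, x_1, \ldots, x_n)$.\<close>

definition set_x0_zero :: "('v option, 'a) mpoly \<Rightarrow> ('v, 'a::comm_ring_1) mpoly" where
  "set_x0_zero g = subst_poly (\<lambda>j. case j of None \<Rightarrow> 0 | Some i \<Rightarrow> mvar i) g"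


section \<open>Monomial orderings and Groebner bases\<close>

text \<open>Monomial orderings are given by their strict part: \<open>ord m m'\<close> means that
  \<open>m\<close> is smaller than \<open>m'\<close>.\<close>

definition monomial_ordering :: "('v monom \<Rightarrow> 'v monom \<Rightarrow> bool) \<Rightarrow> bool" where
  "monomial_ordering ord \<longleftrightarrow>
     irreflp ord \<and> transp ord \<and> totalp ord \<and> wfp ord \<and>
     (\<forall>m m' k. ord m m' \<longrightarrow> ord (m + k) (m' + k))"

definition degree_ordering :: "('v monom \<Rightarrow> 'v monom \<Rightarrow> bool) \<Rightarrow> bool" where
  "degree_ordering ord \<longleftrightarrow>
     monomial_ordering ord \<and> (\<forall>m m'. mdeg m < mdeg m' \<longrightarrow> ord m m')"

definition leading_monom ::
  "('v monom \<Rightarrow> 'v monom \<Rightarrow> bool) \<Rightarrow> ('v, 'a::zero) mpoly \<Rightarrow> 'v monom" where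
  "leading_monom ord f =
    (THE m. m \<in> Poly_Mapping.keys f \<and> (\<forall>m'\<in>Poly_Mapping.keys f. m' \<noteq> m \<longrightarrow> ord m' m))"

definition leading_term ::
  "('v monom \<Rightarrow> 'v monom \<Rightarrow> bool) \<Rightarrow> ('v, 'a::zero) mpoly \<Rightarrow> ('v, 'a) mpoly" where
  "leading_term ord f =
    (if f = 0 then 0
     else Poly_Mapping.single (leading_monom ord f) (Poly_Mapping.lookup f (leading_monom ord f)))"

text \<open>The ideal generated by \<open>S\<close> is the span of \<open>S\<close> in the ring regarded as
  a module over itself.\<close>

definition ideal_generated :: "'r::comm_ring_1 set \<Rightarrow> 'r set" where
  "ideal_generated S = module.span (*) S"

text \<open>
  A Groebner basis of \<open>I\<close> is a finite subset whose leading terms generate the ideal of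
  all leading terms of \<open>I\<close>. The zero polynomial may belong to it, and the zero ideal has
  the Groebner bases \<open>{}\<close> and \<open>{0}\<close>.
\<close>

definition groebner_basis ::
  "('v monom \<Rightarrow> 'v monom \<Rightarrow> bool) \<Rightarrow> ('v, 'a::comm_ring_1) mpoly set \<Rightarrow> ('v, 'a) mpoly set \<Rightarrow> bool"
where
  "groebner_basis ord G I \<longleftrightarrow>
     finite G \<and> G \<subseteq> I \<and>
     ideal_generated (leading_term ord ` G) = ideal_generated (leading_term ord ` I)"


section \<open>Affine varieties and their tangent cones at infinity\<close>

definition zero_locus :: "('n, complex) mpoly set \<Rightarrow> (complex ^ 'n::finite) set" where
  "zero_locus S = {x. \<forall>f\<in>S. eval_at (($) x) f = 0}"

definition algebraic_variety :: "(complex ^ 'n::finite) set \<Rightarrow> bool" where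
  "algebraic_variety V \<longleftrightarrow> (\<exists>S. V = zero_locus S)"

definition vanishing_ideal :: "(complex ^ 'n::finite) set \<Rightarrow> ('n, complex) mpoly set" where
  "vanishing_ideal V = {f. \<forall>x\<in>V. eval_at (($) x) f = 0}"

definition geometric_cone_at_infinity ::
  "(complex ^ 'n::finite) set \<Rightarrow> (complex ^ 'n) set" where
  "geometric_cone_at_infinity V =
     {v. \<exists>(x :: nat \<Rightarrow> complex ^ 'n) (t :: nat \<Rightarrow> complex).
           (\<forall>k. x k \<in> V) \<and> filterlim (\<lambda>k. norm (x k)) at_top sequentially \<and>
           (\<lambda>k. t k *s x k) \<longlonglongrightarrow> v}
     \<union> (if V = {} then {} else {0})"

definition algebraic_cone_at_infinity ::
  "(complex ^ 'n::finite) set \<Rightarrow> (complex ^ 'n) set" where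
  "algebraic_cone_at_infinity V =
     {v. \<forall>f\<in>vanishing_ideal V. eval_at (($) v) (top_form f) = 0}"

text \<open>
  The geometric and the algebraic tangent cone at infinity of an algebraic variety are equal, and
  the tangent cone at infinity is their common value. It is introduced here through the algebraic
  one; \<open>geometric_cone_subset\<close> below is the elementary half of the equality.
\<close>

definition cone_at_infinity :: "(complex ^ 'n::finite) set \<Rightarrow> (complex ^ 'n) set" where
  "cone_at_infinity V = algebraic_cone_at_infinity V"


section \<open>Compatibility of the definitions\<close>

lemma module_times: "module ((*) :: 'r::comm_ring_1 \<Rightarrow> 'r \<Rightarrow> 'r)"
  by unfold_locales (simp_all add: algebra_simps)

lemma ideal_generated_explicit:
  "ideal_generated S = {(\<Sum>a\<in>T. r a * a) | T r. finite T \<and> T \<subseteq> S}"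
  unfolding ideal_generated_def by (rule module.span_explicit[OF module_times])

lemma mdeg_le_total_degree:
  "m \<in> Poly_Mapping.keys f \<Longrightarrow> mdeg m \<le> total_degree f"
  unfolding total_degree_def by (intro Max_ge) auto

lemma eval_at_superset:
  assumes "finite A" "Poly_Mapping.keys f \<subseteq> A"
  shows "eval_at a f =
    (\<Sum>m\<in>A. Poly_Mapping.lookup f m * (\<Prod>i\<in>Poly_Mapping.keys m. a i ^ Poly_Mapping.lookup m i))"
  unfolding eval_at_def eval_with_def id_def
  using assms by (intro sum.mono_neutral_left) (auto simp: in_keys_iff)

lemmas eval_at_explicit = eval_at_superset[OF finite_keys subset_refl]

lemma eval_at_0 [simp]: "eval_at a 0 = 0"
  by (simp add: eval_at_def eval_with_def)

lemma eval_at_add: "eval_at a (f + g) = eval_at a f + eval_at a g"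
proof -
  let ?A = "Poly_Mapping.keys f \<union> Poly_Mapping.keys g"
  have "Poly_Mapping.keys (f + g) \<subseteq> ?A"
    by (rule Poly_Mapping.keys_add)
  then show ?thesis
    by (simp add: eval_at_superset[of ?A] lookup_add distrib_right sum.distrib)
qed

lemma eval_at_sum: "eval_at a (sum F A) = (\<Sum>x\<in>A. eval_at a (F x))"
  by (induction A rule: infinite_finite_induct) (simp_all add: eval_at_add)

lemma eval_at_single:
  "eval_at a (Poly_Mapping.single m c) =
    c * (\<Prod>i\<in>Poly_Mapping.keys m. a i ^ Poly_Mapping.lookup m i)"
  by (simp add: eval_at_superset[of "{m}"])

lemma eval_at_monomial_add:
  "(\<Prod>i\<in>Poly_Mapping.keys (m + n). a i ^ Poly_Mapping.lookup (m + n) i) =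
   (\<Prod>i\<in>Poly_Mapping.keys m. a i ^ Poly_Mapping.lookup m i) *
   (\<Prod>i\<in>Poly_Mapping.keys n. (a i :: 'a::comm_ring_1) ^ Poly_Mapping.lookup n i)"
proof -
  let ?A = "Poly_Mapping.keys m \<union> Poly_Mapping.keys n"
  have *: "(\<Prod>i\<in>Poly_Mapping.keys k. a i ^ Poly_Mapping.lookup k i) =
      (\<Prod>i\<in>?A. a i ^ Poly_Mapping.lookup k i)"
    if "Poly_Mapping.keys k \<subseteq> ?A" for k
    using that by (intro prod.mono_neutral_left) (auto simp: in_keys_iff)
  have "(\<Prod>i\<in>Poly_Mapping.keys (m + n). a i ^ Poly_Mapping.lookup (m + n) i) =
      (\<Prod>i\<in>?A. a i ^ Poly_Mapping.lookup (m + n) i)"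
    by (rule *) (rule Poly_Mapping.keys_add)
  also have "\<dots> = (\<Prod>i\<in>?A. a i ^ Poly_Mapping.lookup m i) *
      (\<Prod>i\<in>?A. a i ^ Poly_Mapping.lookup n i)"
    by (simp add: lookup_add power_add prod.distrib)
  finally show ?thesis
    by (simp add: *[of m] *[of n])
qed

lemma eval_at_mult:
  fixes f g :: "('a, 'b::comm_ring_1) mpoly"
  shows "eval_at a (f * g) = eval_at a f * eval_at a g"
proof -
  have expand: "h = (\<Sum>m\<in>Poly_Mapping.keys h. Poly_Mapping.single m (Poly_Mapping.lookup h m))"
    for h :: "('a, 'b::comm_ring_1) mpoly"
    by (rule poly_mapping_eqI)
      (auto simp: lookup_sum lookup_single when_def in_keys_iff)
  have "f * g = (\<Sum>m\<in>Poly_Mapping.keys f. \<Sum>n\<in>Poly_Mapping.keys g.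
      Poly_Mapping.single (m + n) (Poly_Mapping.lookup f m * Poly_Mapping.lookup g n))"
    using arg_cong2[OF expand[of f] expand[of g], of "(*)"]
    by (simp only: sum_product mult_single)
  then have "eval_at a (f * g) = (\<Sum>m\<in>Poly_Mapping.keys f. \<Sum>n\<in>Poly_Mapping.keys g.
      Poly_Mapping.lookup f m * Poly_Mapping.lookup g n *
      ((\<Prod>i\<in>Poly_Mapping.keys m. a i ^ Poly_Mapping.lookup m i) *
       (\<Prod>i\<in>Poly_Mapping.keys n. a i ^ Poly_Mapping.lookup n i)))"
    by (simp only: eval_at_sum eval_at_single eval_at_monomial_add)
  then show ?thesis
    by (simp only: eval_at_explicit sum_product mult_ac)
qed

lemma eval_at_1 [simp]: "eval_at a 1 = 1"
  using eval_at_single[of a 0 1] by simp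

lemma eval_at_power: "eval_at a (f ^ k) = eval_at a f ^ k"
  by (induction k) (simp_all add: eval_at_mult)

lemma eval_at_prod: "eval_at a (prod F A) = (\<Prod>x\<in>A. eval_at a (F x))"
  by (induction A rule: infinite_finite_induct) (simp_all add: eval_at_mult)

lemma eval_at_mvar [simp]: "eval_at a (mvar i) = a i"
  by (simp add: mvar_def eval_at_single)

lemma eval_at_mconst [simp]: "eval_at a (mconst c) = c"
  by (simp add: mconst_def eval_at_single)

lemma eval_at_subst_poly: "eval_at a (subst_poly \<sigma> f) = eval_at (\<lambda>i. eval_at a (\<sigma> i)) f"
  unfolding subst_poly_def eval_with_def eval_at_sum eval_at_mult eval_at_prod eval_at_power
  unfolding eval_at_explicit[of _ f] by simp

lemma eval_at_homogenize_explicit: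
  "eval_at (case_option x0 x) (homogenize f) =
    (\<Sum>m\<in>Poly_Mapping.keys f. Poly_Mapping.lookup f m * x0 ^ (total_degree f - mdeg m) *
      (\<Prod>i\<in>Poly_Mapping.keys m. x i ^ Poly_Mapping.lookup m i))"
  by (simp add: homogenize_def eval_at_sum eval_at_mult eval_at_prod eval_at_power)

lemma eval_at_homogenize_scaled:
  "eval_at (case_option t (\<lambda>i. t * x i)) (homogenize f) = t ^ total_degree f * eval_at x f"
proof -
  have "Poly_Mapping.lookup f m * t ^ (total_degree f - mdeg m) *
      (\<Prod>i\<in>Poly_Mapping.keys m. (t * x i) ^ Poly_Mapping.lookup m i) =
    t ^ total_degree f * (Poly_Mapping.lookup f m *
      (\<Prod>i\<in>Poly_Mapping.keys m. x i ^ Poly_Mapping.lookup m i))"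
    if "m \<in> Poly_Mapping.keys f" for m
  proof -
    have "(\<Prod>i\<in>Poly_Mapping.keys m. t ^ Poly_Mapping.lookup m i) = t ^ mdeg m"
      by (simp add: mdeg_def power_sum)
    moreover have "t ^ total_degree f = t ^ (total_degree f - mdeg m) * t ^ mdeg m"
      using mdeg_le_total_degree[OF that] by (simp flip: power_add)
    ultimately show ?thesis
      by (simp only: power_mult_distrib prod.distrib) (simp only: mult_ac)
  qed
  then show ?thesis
    unfolding eval_at_homogenize_explicit
    by (simp add: eval_at_def eval_with_def sum_distrib_left)
qed

lemma eval_homogenize:
  fixes x0 :: "'a::field"
  assumes "x0 \<noteq> 0"
  shows "eval_at (case_option x0 x) (homogenize f) =
    x0 ^ total_degree f * eval_at (\<lambda>i. x i / x0) f"
  using eval_at_homogenize_scaled[of x0 "\<lambda>i. x i / x0" f] assms by simp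

lemma eval_at_homogenize_zero:
  "eval_at (case_option 0 x) (homogenize f) = eval_at x (top_form f)"
proof -
  have "eval_at (case_option 0 x) (homogenize f) =
    (\<Sum>m\<in>Poly_Mapping.keys f. if mdeg m = total_degree f then Poly_Mapping.lookup f m *
      (\<Prod>i\<in>Poly_Mapping.keys m. x i ^ Poly_Mapping.lookup m i) else 0)"
    unfolding eval_at_homogenize_explicit
    by (rule sum.cong[OF refl]) (auto dest!: mdeg_le_total_degree simp: power_0_left)
  also have "\<dots> = eval_at x (top_form f)"
    by (simp add: top_form_def eval_at_sum eval_at_single sum.inter_filter)
      (auto intro!: sum.cong simp: eval_at_single)
  finally show ?thesis .
qed

lemma geometric_cone_subset:
  "geometric_cone_at_infinity V \<subseteq> algebraic_cone_at_infinity V"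
proof
  fix v
  assume v: "v \<in> geometric_cone_at_infinity V"
  define H where "H = (\<lambda>f t (y :: complex ^ 'a). eval_at (case_option t (($) y)) (homogenize f))"
  have H0: "H f t (t *s x) = 0" if "f \<in> vanishing_ideal V" "x \<in> V" for f t x
  proof -
    have "(($) (t *s x)) = (\<lambda>i. t * x $ i)"
      by (rule ext) simp
    then show ?thesis
      using that eval_at_homogenize_scaled[of t "($) x" f]
      by (simp add: H_def vanishing_ideal_def)
  qed
  have "\<exists>x t. (\<forall>k. x k \<in> V) \<and> t \<longlonglongrightarrow> (0 :: complex) \<and> (\<lambda>k::nat. t k *s x k) \<longlonglongrightarrow> v"
  proof (cases "v = 0 \<and> V \<noteq> {}")
    case True
    then obtain x where "x \<in> V" by blast
    with True show ?thesis
      by (intro exI[of _ "\<lambda>_. x"] exI[of _ "\<lambda>_. 0"]) simp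
  next
    case False
    with v obtain x t where x: "\<forall>k. x k \<in> V"
      and inf: "filterlim (\<lambda>k. norm (x k)) at_top sequentially"
      and lim: "(\<lambda>k. t k *s x k) \<longlonglongrightarrow> v"
      by (auto simp: geometric_cone_at_infinity_def split: if_splits)
    have norm_eq: "norm (c *s y) = norm c * norm y" for c :: complex and y :: "complex ^ 'a"
      by (simp add: norm_vec_def norm_mult L2_set_right_distrib)
    have "(\<lambda>k. norm (t k *s x k) / norm (x k)) \<longlonglongrightarrow> 0"
      using tendsto_norm[OF lim] inf
      by (intro tendsto_divide_0[where F = sequentially])
        (auto intro: filterlim_at_top_imp_at_infinity)
    moreover have "eventually (\<lambda>k. norm (x k) > 0) sequentially"
      using inf unfolding filterlim_at_top_dense by blast
    then have "eventually (\<lambda>k. norm (t k *s x k) / norm (x k) = norm (t k)) sequentially"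
      by eventually_elim (simp add: norm_eq)
    ultimately have "(\<lambda>k. norm (t k)) \<longlonglongrightarrow> 0"
      using tendsto_cong by fast
    with x lim show ?thesis
      using tendsto_norm_zero_iff by blast
  qed
  then obtain x t where x: "\<And>k. x k \<in> V" and t: "t \<longlonglongrightarrow> (0 :: complex)"
    and lim: "(\<lambda>k::nat. t k *s x k) \<longlonglongrightarrow> v"
    by blast
  show "v \<in> algebraic_cone_at_infinity V"
    unfolding algebraic_cone_at_infinity_def
  proof safe
    fix f
    assume f: "f \<in> vanishing_ideal V"
    have "(\<lambda>k. H f (t k) (t k *s x k)) \<longlonglongrightarrow> H f 0 v"
      unfolding H_def eval_at_homogenize_explicit
      by (intro tendsto_intros t lim tendsto_vec_nth)
    then have "H f 0 v = 0"
      using H0[OF f x] by (simp add: LIMSEQ_const_iff)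
    then show "eval_at (($) v) (top_form f) = 0"
      by (simp add: H_def eval_at_homogenize_zero)
  qed
qed

end

theory Submission
  imports Defs
begin

text \<open>
  Both sides are cut out by top forms, since \<open>g\<^sup>h\<close> restricted to $x_0 = 0$ is the top
  form of \<open>g\<close>. If the top forms of the Groebner basis vanish at \<open>v\<close>, divide
  \<open>f\<close> by the basis: each step subtracts a monomial multiple of some \<open>g\<close>, and because
  the ordering refines the degree, the multiple has degree at most that of \<open>f\<close>, so it
  contributes to the degree-\<open>d\<close> part of \<open>f\<close>, \<open>d \<ge> deg f\<close>, either nothing or a
  multiple of the top form of \<open>g\<close>.
\<close>

text \<open>Unlike \<open>top_form\<close>, whose degree depends on the polynomial, the part in a
  fixed degree \<open>d\<close> is additive, so it can be followed through the subtractions of the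
  division.\<close>

definition homogeneous_part ::
  "nat \<Rightarrow> ('v, 'a) mpoly \<Rightarrow> ('v, 'a::comm_monoid_add) mpoly" where
  "homogeneous_part d f =
    (\<Sum>m\<in>{m \<in> Poly_Mapping.keys f. mdeg m = d}. Poly_Mapping.single m (Poly_Mapping.lookup f m))"

lemma top_form_eq_homogeneous_part: "top_form f = homogeneous_part (total_degree f) f"
  by (simp add: top_form_def homogeneous_part_def)

lemma lookup_homogeneous_part:
  "Poly_Mapping.lookup (homogeneous_part d f) m = (Poly_Mapping.lookup f m when mdeg m = d)"
  by (auto simp: homogeneous_part_def lookup_sum lookup_single when_def in_keys_iff)

lemma homogeneous_part_add:
  "homogeneous_part d (f + g) = homogeneous_part d f + homogeneous_part d g"
  by (rule poly_mapping_eqI) (simp add: lookup_homogeneous_part lookup_add when_def)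

lemma homogeneous_part_0 [simp]: "homogeneous_part d 0 = 0"
  by (simp add: homogeneous_part_def)

lemma homogeneous_part_sum: "homogeneous_part d (sum F A) = (\<Sum>x\<in>A. homogeneous_part d (F x))"
  by (induction A rule: infinite_finite_induct) (simp_all add: homogeneous_part_add)

lemma homogeneous_part_single:
  "homogeneous_part d (Poly_Mapping.single m c) = (if mdeg m = d then Poly_Mapping.single m c else 0)"
  by (rule poly_mapping_eqI) (auto simp: lookup_homogeneous_part lookup_single when_def)

lemma homogeneous_part_eq_0: "total_degree f < d \<Longrightarrow> homogeneous_part d f = 0"
  by (rule poly_mapping_eqI)
    (use mdeg_le_total_degree[of _ f] in
      \<open>fastforce simp: lookup_homogeneous_part when_def in_keys_iff\<close>)

lemma mdeg_add: "mdeg (m + n) = mdeg m + mdeg n"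
proof -
  let ?A = "Poly_Mapping.keys m \<union> Poly_Mapping.keys n"
  have *: "mdeg k = (\<Sum>i\<in>?A. Poly_Mapping.lookup k i)" if "Poly_Mapping.keys k \<subseteq> ?A" for k
    unfolding mdeg_def using that by (intro sum.mono_neutral_left) (auto simp: in_keys_iff)
  show ?thesis
    using *[OF Poly_Mapping.keys_add] *[of m] *[of n] by (simp add: lookup_add sum.distrib)
qed

lemma sum_monomials:
  "(\<Sum>m\<in>Poly_Mapping.keys f. Poly_Mapping.single m (Poly_Mapping.lookup f m)) = f"
  by (rule poly_mapping_eqI) (auto simp: lookup_sum lookup_single when_def in_keys_iff)

lemma single_times:
  fixes f :: "('v, 'a::comm_ring_1) mpoly"
  shows "Poly_Mapping.single k c * f =
    (\<Sum>m\<in>Poly_Mapping.keys f. Poly_Mapping.single (k + m) (c * Poly_Mapping.lookup f m))"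
  by (subst sum_monomials[of f, symmetric]) (simp only: sum_distrib_left mult_single)

lemma lookup_single_times:
  fixes f :: "('v, 'a::comm_ring_1) mpoly"
  shows "Poly_Mapping.lookup (Poly_Mapping.single k c * f) (k + m) = c * Poly_Mapping.lookup f m"
  by (auto simp: single_times lookup_sum lookup_single when_def in_keys_iff)

lemma keys_single_times:
  fixes f :: "('v, 'a::comm_ring_1) mpoly"
  shows "Poly_Mapping.keys (Poly_Mapping.single k c * f) \<subseteq> (+) k ` Poly_Mapping.keys f"
  using keys_mult[of "Poly_Mapping.single k c" f] by (auto split: if_splits)

text \<open>A monomial factor shifts the grading by \<open>mdeg k\<close>. Writing the degree as a
  sum avoids truncated subtraction.\<close>

lemma homogeneous_part_single_times:
  fixes f :: "('v, 'a::comm_ring_1) mpoly"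
  shows "homogeneous_part (mdeg k + d) (Poly_Mapping.single k c * f) =
    Poly_Mapping.single k c * homogeneous_part d f"
proof -
  have "homogeneous_part (mdeg k + d) (Poly_Mapping.single k c * f) =
    (\<Sum>m\<in>Poly_Mapping.keys f. if mdeg m = d
       then Poly_Mapping.single (k + m) (c * Poly_Mapping.lookup f m) else 0)"
    by (simp add: single_times homogeneous_part_sum homogeneous_part_single mdeg_add)
  also have "\<dots> = Poly_Mapping.single k c * homogeneous_part d f"
    by (auto simp: homogeneous_part_def sum_distrib_left mult_single sum.inter_filter
        intro!: sum.cong)
  finally show ?thesis .
qed

lemma monomial_ordering_asymp: "monomial_ordering ord \<Longrightarrow> asymp ord"
  by (simp add: monomial_ordering_def asymp_on_iff_irreflp_on_if_transp_on)

text \<open>Justifies the definite description: a finite nonempty set has a greatest element for a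
  transitive total relation, and asymmetry makes it unique.\<close>

lemma leading_monom:
  assumes "monomial_ordering ord" "f \<noteq> 0"
  shows leading_monom_in_keys: "leading_monom ord f \<in> Poly_Mapping.keys f"
    and less_leading_monom:
      "m \<in> Poly_Mapping.keys f \<Longrightarrow> m \<noteq> leading_monom ord f \<Longrightarrow> ord m (leading_monom ord f)"
proof -
  have asym: "asymp ord" and trans: "transp ord" and total: "totalp ord"
    using assms(1) monomial_ordering_asymp by (simp_all add: monomial_ordering_def)
  have "Poly_Mapping.keys f \<noteq> {}"
    using assms(2) by simp
  then obtain g where g: "g \<in> Poly_Mapping.keys f"
    "\<forall>m\<in>Poly_Mapping.keys f. m \<noteq> g \<longrightarrow> ord m g"
    using Finite_Set.bex_greatest_element[OF finite_keys _ transp_on_subset[OF trans subset_UNIV]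
        totalp_on_subset[OF total subset_UNIV]]
    by blast
  have "leading_monom ord f = g"
    unfolding leading_monom_def
  proof (rule the_equality)
    fix m
    assume "m \<in> Poly_Mapping.keys f \<and> (\<forall>m'\<in>Poly_Mapping.keys f. m' \<noteq> m \<longrightarrow> ord m' m)"
    with g show "m = g"
      using asympD[OF asym, of m g] by (metis (full_types))
  qed (use g in blast)
  with g show "leading_monom ord f \<in> Poly_Mapping.keys f"
    and "m \<in> Poly_Mapping.keys f \<Longrightarrow> m \<noteq> leading_monom ord f \<Longrightarrow> ord m (leading_monom ord f)"
    by blast+
qed

text \<open>A monomial of larger degree would also be larger for \<open>ord\<close>, against
  maximality and asymmetry.\<close>

lemma mdeg_leading_monom:
  assumes "degree_ordering ord" "f \<noteq> 0"
  shows "mdeg (leading_monom ord f) = total_degree f"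
proof -
  have mo: "monomial_ordering ord" and deg: "\<And>m m'. mdeg m < mdeg m' \<Longrightarrow> ord m m'"
    using assms(1) by (auto simp: degree_ordering_def)
  note lm = leading_monom_in_keys[OF mo assms(2)] less_leading_monom[OF mo assms(2)]
  have "mdeg m \<le> mdeg (leading_monom ord f)" if "m \<in> Poly_Mapping.keys f" for m
    using lm(2)[OF that] deg[of "leading_monom ord f" m]
      asympD[OF monomial_ordering_asymp[OF mo], of m "leading_monom ord f"]
    by (cases "m = leading_monom ord f") (auto simp: not_less[symmetric])
  then show ?thesis
    unfolding total_degree_def using lm(1) by (intro Max_eqI[symmetric]) auto
qed

text \<open>In a combination of leading terms from \<open>G\<close> some summand must contain the
  leading monomial of \<open>f\<close>. The generator in that summand is a single term, so all
  monomials of the summand are multiples of its monomial.\<close>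

lemma leading_monom_multiple:
  assumes f: "f \<in> I" "f \<noteq> 0" and mo: "monomial_ordering ord" and gb: "groebner_basis ord G I"
  obtains g k where "g \<in> G" "g \<noteq> 0" "leading_monom ord f = k + leading_monom ord g"
proof -
  let ?m = "leading_monom ord f"
  have "leading_term ord f \<in> ideal_generated (leading_term ord ` I)"
    unfolding ideal_generated_def using f by (intro module.span_base[OF module_times]) simp
  then have "leading_term ord f \<in> ideal_generated (leading_term ord ` G)"
    using gb by (simp add: groebner_basis_def)
  then obtain T r where T: "T \<subseteq> leading_term ord ` G" "leading_term ord f = (\<Sum>a\<in>T. r a * a)"
    unfolding ideal_generated_explicit by blast
  have "Poly_Mapping.lookup (leading_term ord f) ?m \<noteq> 0"
    using f leading_monom_in_keys[OF mo f(2)] by (simp add: leading_term_def in_keys_iff)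
  then have "(\<Sum>a\<in>T. Poly_Mapping.lookup (r a * a) ?m) \<noteq> 0"
    by (simp add: T(2) lookup_sum)
  then obtain a where a: "a \<in> T" "?m \<in> Poly_Mapping.keys (r a * a)"
    by (metis (no_types, lifting) in_keys_iff sum.neutral)
  then obtain g where g: "g \<in> G" "a = leading_term ord g"
    using T(1) by blast
  \<comment> \<open>The leading term of 0 is 0, and no multiple of it contains a monomial.\<close>
  from a(2) have "g \<noteq> 0"
    by (auto simp: g leading_term_def)
  moreover obtain k where "?m = k + leading_monom ord g"
    using subsetD[OF keys_mult a(2)] \<open>g \<noteq> 0\<close>
    by (auto simp: g leading_term_def split: if_splits)
  ultimately show ?thesis
    using that g(1) by blast
qed

lemma reduce_leading_term:
  fixes f g :: "('v, 'a::field) mpoly"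
  assumes "degree_ordering ord" "f \<noteq> 0" "g \<noteq> 0"
    and m: "leading_monom ord f = k + leading_monom ord g"
  obtains c where
    "f - Poly_Mapping.single k c * g = 0 \<or>
     ord (leading_monom ord (f - Poly_Mapping.single k c * g)) (leading_monom ord f)"
    "total_degree (f - Poly_Mapping.single k c * g) \<le> total_degree f"
proof -
  have mo: "monomial_ordering ord"
    using assms(1) by (simp add: degree_ordering_def)
  \<comment> \<open>The quotient of the leading coefficients makes the leading terms cancel.\<close>
  define c where "c = Poly_Mapping.lookup f (leading_monom ord f) /
    Poly_Mapping.lookup g (leading_monom ord g)"
  define h where "h = f - Poly_Mapping.single k c * g"
  have "Poly_Mapping.lookup g (leading_monom ord g) \<noteq> 0"
    using leading_monom_in_keys[OF mo assms(3)] by (simp add: in_keys_iff)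
  then have "Poly_Mapping.lookup h (leading_monom ord f) = 0"
    by (simp add: h_def lookup_minus m lookup_single_times) (simp add: c_def m)
  moreover have "ord (k + n) (k + leading_monom ord g)"
    if "n \<in> Poly_Mapping.keys g" "n \<noteq> leading_monom ord g" for n
    using less_leading_monom[OF mo assms(3) that] mo
    by (simp add: monomial_ordering_def add.commute[of k])
  moreover have "Poly_Mapping.keys h \<subseteq> Poly_Mapping.keys f \<union> (+) k ` Poly_Mapping.keys g"
    using keys_diff[of f "Poly_Mapping.single k c * g"] keys_single_times[of k c g]
    unfolding h_def by blast
  \<comment> \<open>The leading monomial itself has cancelled; every other monomial comes from
    \<open>f\<close> or from a translate by \<open>k\<close> of a non-leading monomial of
    \<open>g\<close>.\<close>
  ultimately have less: "ord n (leading_monom ord f)" if "n \<in> Poly_Mapping.keys h" for n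
    using that less_leading_monom[OF mo assms(2), of n] unfolding m
    by (metis (no_types, lifting) Un_iff imageE in_keys_iff subsetD)
  have "h = 0 \<or> ord (leading_monom ord h) (leading_monom ord f)"
    using less leading_monom_in_keys[OF mo] by blast
  moreover have "total_degree h \<le> total_degree f"
  proof -
    \<comment> \<open>A larger degree would reverse the comparison in \<open>less\<close>.\<close>
    have "mdeg n \<le> mdeg (leading_monom ord f)" if "n \<in> Poly_Mapping.keys h" for n
      using less[OF that] assms(1) unfolding degree_ordering_def monomial_ordering_def
      by (metis irreflpD leI transpD)
    then show ?thesis
      by (auto simp: total_degree_def[of h] simp flip: mdeg_leading_monom[OF assms(1,2)])
  qed
  ultimately show ?thesis
    using that[of c] by (simp add: h_def)
qed

lemma top_form_vanishes_if_groebner_basis: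
  fixes I :: "('v, 'a::field) mpoly set"
  assumes ord: "degree_ordering ord" and gb: "groebner_basis ord G I"
    and I: "module.subspace (*) I"
    and G: "\<And>g. g \<in> G \<Longrightarrow> eval_at v (top_form g) = 0"
    and "f \<in> I"
  shows "eval_at v (top_form f) = 0"
proof -
  have mo: "monomial_ordering ord" and wf: "wfp ord"
    using ord by (auto simp: degree_ordering_def monomial_ordering_def)
  \<comment> \<open>In degree \<open>total_degree g\<close> this is the top form; above it the part
    is zero.\<close>
  have Gd: "eval_at v (homogeneous_part d g) = 0" if "g \<in> G" "total_degree g \<le> d" for g d
    using G[OF that(1)] that(2) homogeneous_part_eq_0[of g d]
    by (cases "total_degree g = d") (auto simp: top_form_eq_homogeneous_part)
  \<comment> \<open>Degrees above that of \<open>f\<close> are included because division may lower the degree.\<close>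
  have "eval_at v (homogeneous_part d f) = 0"
    if "f \<in> I" "f \<noteq> 0" "total_degree f \<le> d" for f d
    using that
  \<comment> \<open>The difference stays in \<open>I\<close>, so as long as it is nonzero its
    leading monomial is again divisible by one from \<open>G\<close>: no remainder arises.\<close>
  proof (induction "leading_monom ord f" arbitrary: f rule: wfp_induct_rule[OF wf])
    case (1 f)
    obtain g k where g: "g \<in> G" "g \<noteq> 0" and m: "leading_monom ord f = k + leading_monom ord g"
      using leading_monom_multiple[OF 1(2,3) mo gb] .
    obtain c where c: "f - Poly_Mapping.single k c * g = 0 \<or>
        ord (leading_monom ord (f - Poly_Mapping.single k c * g)) (leading_monom ord f)"
      "total_degree (f - Poly_Mapping.single k c * g) \<le> total_degree f"
      using reduce_leading_term[OF ord 1(3) g(2) m] .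
    define h where "h = f - Poly_Mapping.single k c * g"
    have "g \<in> I"
      using g gb by (auto simp: groebner_basis_def)
    then have "h \<in> I"
      unfolding h_def using 1(2) I
      by (intro module.subspace_diff[OF module_times] module.subspace_scale[OF module_times])
    then have h: "eval_at v (homogeneous_part d h) = 0"
      using 1(1)[of h] c 1(4) by (cases "h = 0") (auto simp: h_def)
    \<comment> \<open>The left side is the degree of the leading monomial of \<open>f\<close>, hence
      \<open>total_degree f\<close>. Then \<open>e\<close> is the degree in which \<open>g\<close>
      contributes to degree \<open>d\<close>.\<close>
    have "mdeg k + total_degree g \<le> d"
      using 1(4) m mdeg_leading_monom[OF ord] 1(3) g(2) by (metis mdeg_add)
    then obtain e where e: "d = mdeg k + e" "total_degree g \<le> e"
      by (metis add.assoc le_add1 le_iff_add)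
    have "f = Poly_Mapping.single k c * g + h"
      by (simp add: h_def)
    then have "eval_at v (homogeneous_part d f) =
        eval_at v (Poly_Mapping.single k c) * eval_at v (homogeneous_part e g)
        + eval_at v (homogeneous_part d h)"
      by (simp only: homogeneous_part_add eval_at_add e(1) homogeneous_part_single_times
          eval_at_mult)
    then show ?case
      by (simp add: h Gd[OF g(1) e(2)])
  qed
  then show ?thesis
    using \<open>f \<in> I\<close> by (cases "f = 0") (auto simp: top_form_eq_homogeneous_part)
qed

text \<open>Subspaces of the ring as a module over itself are its ideals.\<close>

lemma subspace_vanishing_ideal: "module.subspace (*) (vanishing_ideal V)"
  by (simp add: module.subspace_def[OF module_times] vanishing_ideal_def eval_at_add eval_at_mult)

lemma eval_at_set_x0_zero: "eval_at x (set_x0_zero g) = eval_at (case_option 0 x) g"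
  unfolding set_x0_zero_def eval_at_subst_poly
  by (rule arg_cong[of _ _ "\<lambda>a. eval_at a g"]) (auto split: option.split)

theorem corollary3p1:
  fixes V :: "(complex ^ 'n::finite) set"
    and ord :: "'n monom \<Rightarrow> 'n monom \<Rightarrow> bool"
    and G :: "('n, complex) mpoly set"
  assumes "algebraic_variety V"
    and "degree_ordering ord"
    and "groebner_basis ord G (vanishing_ideal V)"
  shows "cone_at_infinity V = zero_locus ((\<lambda>g. set_x0_zero (homogenize g)) ` G)"
proof -
  have "zero_locus ((\<lambda>g. set_x0_zero (homogenize g)) ` G) =
      {v. \<forall>g\<in>G. eval_at (($) v) (top_form g) = 0}"
    by (simp add: zero_locus_def eval_at_set_x0_zero eval_at_homogenize_zero)
  \<comment> \<open>This gives the inclusion of the cone in the zero locus; the division argument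
    gives the converse.\<close>
  moreover have "G \<subseteq> vanishing_ideal V"
    using assms(3) by (simp add: groebner_basis_def)
  moreover note top_form_vanishes_if_groebner_basis[OF assms(2,3) subspace_vanishing_ideal]
  ultimately show ?thesis
    unfolding cone_at_infinity_def algebraic_cone_at_infinity_def by blast
qed

end
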